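(* Let $n$ be a prime and $c\in\mathbb{F}_n\setminus\{0,1,-1,-2\}$. Let $X=X_{2,n,c}$ be the $2$-dimensional simplicial complex on vertex set $\mathbb{F}_n$ containing all vertices and all edges (pairs), whose $2$-faces are the $3$-element sets $\{x_0,x_1,x_2\}\subseteq\mathbb{F}_n$ whose elements can be labeled so that $x_0+x_1+c x_2\equiv 0\pmod n$. Then $X$ is not $\mathbb{Q}$-acyclic (i.e., $H_2(X;\mathbb{Q})\neq 0$, so $X$ is not a hypertree) in each of the following cases: (i) $n\equiv 1\pmod 4$ and $c$ is not a primitive element (generator of $\mathbb{F}_n^*$); (ii) $n\equiv 3\pmod 4$ and $c$ is neither a primitive element nor of multiplicative order $\frac{n-1}{2}$. *)

theory Defs
  imports "HOL-Number_Theory.Number_Theory" "HOL-Algebra.Elementary_Groups"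
begin

section \<open>Finite simplicial complexes and their reduced rational homology\<close>

text \<open>
  A complex contains the empty simplex, of dimension \<open>-1\<close>. Its chain complex is thus the augmented
  one and the homology below is reduced homology, which agrees with ordinary homology in every
  dimension \<open>k \<ge> 1\<close>.
\<close>

definition simplicial_complex :: "'a set \<Rightarrow> 'a set set \<Rightarrow> bool" where
  "simplicial_complex V K \<longleftrightarrow>
     finite V \<and> K \<subseteq> Pow V \<and> {} \<in> K \<and> (\<forall>v\<in>V. {v} \<in> K) \<and> (\<forall>\<sigma>\<in>K. \<forall>\<tau>\<subseteq>\<sigma>. \<tau> \<in> K)"

definition simplex_dim :: "'a set \<Rightarrow> int" where
  "simplex_dim \<sigma> = int (card \<sigma>) - 1"

definition faces :: "'a set set \<Rightarrow> int \<Rightarrow> 'a set set" where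
  "faces K k = {\<sigma>\<in>K. simplex_dim \<sigma> = k}"

definition chain_group :: "'a set set \<Rightarrow> int \<Rightarrow> ('a set \<Rightarrow> rat) monoid" where
  "chain_group K k = \<lparr>carrier = {f. \<forall>\<sigma>. \<sigma> \<notin> faces K k \<longrightarrow> f \<sigma> = 0},
                 mult = (\<lambda>f g \<sigma>. f \<sigma> + g \<sigma>), one = (\<lambda>_. 0)\<rparr>"

text \<open>
  Simplices are oriented by the vertex order: for \<open>v\<^sub>0 < \<dots> < v\<^sub>k\<close> the boundary of
  \<open>{v\<^sub>0, \<dots>, v\<^sub>k}\<close> is the sum over \<open>i\<close> of \<open>(-1)^i\<close> times the simplex without \<open>v\<^sub>i\<close>. The index \<open>i\<close> is
  the number of vertices below \<open>v\<^sub>i\<close>.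
\<close>

definition simplex_boundary :: "'a::linorder set \<Rightarrow> 'a set \<Rightarrow> rat" where
  "simplex_boundary \<sigma> \<tau> =
     (\<Sum>v\<in>\<sigma>. (- 1) ^ card {u\<in>\<sigma>. u < v} * (if \<tau> = \<sigma> - {v} then 1 else 0))"

definition boundary :: "'a::linorder set set \<Rightarrow> int \<Rightarrow> ('a set \<Rightarrow> rat) \<Rightarrow> 'a set \<Rightarrow> rat" where
  "boundary K k f \<tau> = (\<Sum>\<sigma>\<in>faces K k. f \<sigma> * simplex_boundary \<sigma> \<tau>)"

definition cycle_group :: "'a::linorder set set \<Rightarrow> int \<Rightarrow> ('a set \<Rightarrow> rat) monoid" where
  "cycle_group K k = (chain_group K k)\<lparr>carrier := {f \<in> carrier (chain_group K k). boundary K k f = (\<lambda>_. 0)}\<rparr>"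

definition boundaries :: "'a::linorder set set \<Rightarrow> int \<Rightarrow> ('a set \<Rightarrow> rat) set" where
  "boundaries K k = boundary K (k + 1) ` carrier (chain_group K (k + 1))"

definition homology :: "'a::linorder set set \<Rightarrow> int \<Rightarrow> ('a set \<Rightarrow> rat) set monoid" where
  "homology K k = cycle_group K k Mod boundaries K k"

definition Q_acyclic :: "'a::linorder set set \<Rightarrow> bool" where
  "Q_acyclic K \<longleftrightarrow> (\<forall>k. trivial_group (homology K k))"

definition hypertree :: "nat \<Rightarrow> 'a::linorder set \<Rightarrow> 'a set set \<Rightarrow> bool" where
  "hypertree d V K \<longleftrightarrow>
     simplicial_complex V K \<and>
     (\<forall>\<sigma>\<in>K. simplex_dim \<sigma> \<le> int d) \<and> (\<exists>\<sigma>\<in>K. simplex_dim \<sigma> = int d) \<and>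
     (\<forall>\<sigma>\<subseteq>V. simplex_dim \<sigma> < int d \<longrightarrow> \<sigma> \<in> K) \<and>
     Q_acyclic K"


section \<open>The complexes\<close>

text \<open>\<open>\<F>\<^sub>n\<close> is represented by the residues \<open>{..<n}\<close>, with arithmetic modulo \<open>n\<close>.\<close>

definition sum_complex :: "nat \<Rightarrow> nat \<Rightarrow> nat set set" where
  "sum_complex n c =
     {\<sigma>. \<sigma> \<subseteq> {..<n} \<and> card \<sigma> \<le> 2} \<union>
     {\<sigma>. \<sigma> \<subseteq> {..<n} \<and> card \<sigma> = 3 \<and>
         (\<exists>x\<^sub>0 x\<^sub>1 x\<^sub>2. \<sigma> = {x\<^sub>0, x\<^sub>1, x\<^sub>2} \<and> [x\<^sub>0 + x\<^sub>1 + c * x\<^sub>2 = 0] (mod n))}"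


section \<open>Well-definedness\<close>

lemma simplicial_complex_sum_complex: "simplicial_complex {..<n} (sum_complex n c)"
proof -
  have *: "card \<tau> \<le> 2 \<or> \<tau> = \<sigma>" if "\<tau> \<subseteq> \<sigma>" "\<sigma> \<subseteq> {..<n}" "card \<sigma> = 3" for \<sigma> \<tau> :: "nat set"
  proof -
    have "finite \<sigma>" using that finite_subset by blast
    thus ?thesis using psubset_card_mono[of \<sigma> \<tau>] that by fastforce
  qed
  have **: "card \<tau> \<le> 2" if "\<tau> \<subseteq> \<sigma>" "\<sigma> \<subseteq> {..<n}" "card \<sigma> \<le> 2" for \<sigma> \<tau> :: "nat set"
    using card_mono[of \<sigma> \<tau>] finite_subset[of \<sigma> "{..<n}"] that by force
  have "\<tau> \<in> sum_complex n c" if "\<sigma> \<in> sum_complex n c" "\<tau> \<subseteq> \<sigma>" for \<sigma> \<tau>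
  proof -
    have \<sigma>: "\<sigma> \<subseteq> {..<n}" using that(1) by (auto simp: sum_complex_def)
    show ?thesis
    proof (cases "card \<sigma> \<le> 2")
      case True
      thus ?thesis using **[OF that(2) \<sigma>] \<sigma> that(2) by (auto simp: sum_complex_def)
    next
      case False
      hence "card \<sigma> = 3" using that(1) by (auto simp: sum_complex_def)
      hence "card \<tau> \<le> 2 \<or> \<tau> = \<sigma>" using * that(2) \<sigma> by blast
      thus ?thesis
      proof
        assume "card \<tau> \<le> 2"
        thus ?thesis using \<sigma> that(2) by (auto simp: sum_complex_def)
      qed (use that in simp)
    qed
  qed
  moreover have "{} \<in> sum_complex n c" "\<forall>v\<in>{..<n}. {v} \<in> sum_complex n c"
    "sum_complex n c \<subseteq> Pow {..<n}"
    by (auto simp: sum_complex_def)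
  ultimately show ?thesis
    unfolding simplicial_complex_def by blast
qed

lemma comm_group_chains: "comm_group (chain_group K k)"
proof (rule comm_groupI)
  fix f assume "f \<in> carrier (chain_group K k)"
  thus "\<exists>g\<in>carrier (chain_group K k). g \<otimes>\<^bsub>chain_group K k\<^esub> f = \<one>\<^bsub>chain_group K k\<^esub>"
    by (intro bexI[of _ "\<lambda>\<sigma>. - f \<sigma>"]) (auto simp: chain_group_def)
qed (auto simp: chain_group_def algebra_simps)

lemma boundary_add: "boundary K k (\<lambda>\<sigma>. f \<sigma> + g \<sigma>) \<tau> = boundary K k f \<tau> + boundary K k g \<tau>"
  by (simp add: boundary_def algebra_simps sum.distrib)

lemma boundary_zero: "boundary K k (\<lambda>_. 0) = (\<lambda>_. 0)"
  by (simp add: boundary_def fun_eq_iff)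

lemma boundary_minus: "boundary K k (\<lambda>\<sigma>. - f \<sigma>) \<tau> = - boundary K k f \<tau>"
  by (simp add: boundary_def sum_negf)

lemma chains_inv:
  assumes "f \<in> carrier (chain_group K k)"
  shows "inv\<^bsub>chain_group K k\<^esub> f = (\<lambda>\<sigma>. - f \<sigma>)"
proof -
  interpret comm_group "chain_group K k" by (rule comm_group_chains)
  show ?thesis
    by (rule inv_equality) (use assms in \<open>auto simp: chain_group_def\<close>)
qed

lemma comm_group_cycles: "comm_group (cycle_group K k)"
proof -
  interpret comm_group "chain_group K k" by (rule comm_group_chains)
  have "subgroup {f \<in> carrier (chain_group K k). boundary K k f = (\<lambda>_. 0)} (chain_group K k)"
  proof (rule subgroupI, goal_cases)
    case 2
    have "(\<lambda>_. 0) \<in> carrier (chain_group K k)" by (simp add: chain_group_def)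
    thus ?case using boundary_zero by blast
  next
    case (3 f)
    thus ?case using inv_closed[of f]
      by (auto simp: chains_inv fun_eq_iff boundary_minus)
  next
    case (4 f g)
    hence "f \<otimes>\<^bsub>chain_group K k\<^esub> g \<in> carrier (chain_group K k)" by simp
    moreover have "f \<otimes>\<^bsub>chain_group K k\<^esub> g = (\<lambda>\<sigma>. f \<sigma> + g \<sigma>)" by (simp add: chain_group_def)
    moreover have "boundary K k (\<lambda>\<sigma>. f \<sigma> + g \<sigma>) = (\<lambda>_. 0)"
      using 4 by (simp add: fun_eq_iff boundary_add)
    ultimately show ?case by simp
  qed auto
  hence "Group.group (cycle_group K k)"
    unfolding cycle_group_def by (intro subgroup.subgroup_is_group group_axioms)
  thus ?thesis
    by (rule group.group_comm_groupI) (auto simp: cycle_group_def m_comm)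
qed

lemma finite_simplex: "simplicial_complex V K \<Longrightarrow> \<sigma> \<in> K \<Longrightarrow> finite \<sigma>"
  by (auto simp: simplicial_complex_def dest: finite_subset)

lemma finite_faces: "simplicial_complex V K \<Longrightarrow> finite (faces K k)"
  by (auto simp: simplicial_complex_def faces_def intro: finite_subset[of _ "Pow V"])

lemma faces_diff:
  assumes "simplicial_complex V K" "\<sigma> \<in> faces K k" "v \<in> \<sigma>"
  shows "\<sigma> - {v} \<in> faces K (k - 1)"
proof -
  have "finite \<sigma>" "\<sigma> \<in> K" using assms finite_simplex by (auto simp: faces_def)
  moreover from this have "card \<sigma> > 0" using assms(3) card_gt_0_iff by blast
  moreover have "\<sigma> - {v} \<in> K"
    using assms(1) \<open>\<sigma> \<in> K\<close> unfolding simplicial_complex_def by blast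
  ultimately show ?thesis
    using assms by (auto simp: faces_def simplex_dim_def of_nat_diff)
qed

lemma boundary_closed:
  assumes "simplicial_complex V K"
  shows "boundary K k f \<in> carrier (chain_group K (k - 1))"
proof -
  have "simplex_boundary \<sigma> \<tau> = 0" if "\<sigma> \<in> faces K k" "\<tau> \<notin> faces K (k - 1)" for \<sigma> \<tau>
    using faces_diff[OF assms that(1)] that(2)
    unfolding simplex_boundary_def by (intro sum.neutral) auto
  thus ?thesis
    by (auto simp: chain_group_def boundary_def intro!: sum.neutral)
qed

lemma simplex_boundary_boundary:
  assumes "finite \<sigma>"
  shows "(\<Sum>v\<in>\<sigma>. (- 1) ^ card {u\<in>\<sigma>. u < v} * simplex_boundary (\<sigma> - {v}) \<rho>) = 0"
proof -
  define t where "t v w = (- 1 :: rat) ^ card {u\<in>\<sigma>. u < v} * ((- 1) ^ card {u\<in>\<sigma> - {v}. u < w} *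
    (if \<rho> = \<sigma> - {v} - {w} then 1 else 0))" for v w
  have anti: "t w v = - t v w" if "v \<in> \<sigma>" "w \<in> \<sigma>" "v < w" for v w
  proof -
    have 1: "{u\<in>\<sigma> - {w}. u < v} = {u\<in>\<sigma>. u < v}" using that by auto
    have "{u\<in>\<sigma>. u < w} = insert v {u\<in>\<sigma> - {v}. u < w}" using that by auto
    hence 2: "card {u\<in>\<sigma>. u < w} = Suc (card {u\<in>\<sigma> - {v}. u < w})"
      using assms by simp
    have 3: "\<sigma> - {w} - {v} = \<sigma> - {v} - {w}" by blast
    show ?thesis unfolding t_def 1 2 3 by simp
  qed
  have "(\<Sum>v\<in>\<sigma>. (- 1) ^ card {u\<in>\<sigma>. u < v} * simplex_boundary (\<sigma> - {v}) \<rho>)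
      = (\<Sum>v\<in>\<sigma>. \<Sum>w\<in>\<sigma> - {v}. t v w)"
    by (simp add: simplex_boundary_def t_def sum_distrib_left)
  also have "\<dots> = (\<Sum>v\<in>\<sigma>. \<Sum>w\<in>\<sigma>. if v = w then 0 else t v w)"
  proof (rule sum.cong[OF refl])
    fix v assume "v \<in> \<sigma>"
    hence "(\<Sum>w\<in>\<sigma>. if v = w then 0 else t v w) = (\<Sum>w\<in>\<sigma> - {v}. if v = w then 0 else t v w)"
      using assms by (subst sum.remove[of _ v]) auto
    also have "\<dots> = (\<Sum>w\<in>\<sigma> - {v}. t v w)"
      by (intro sum.cong) auto
    finally show "(\<Sum>w\<in>\<sigma> - {v}. t v w) = (\<Sum>w\<in>\<sigma>. if v = w then 0 else t v w)" ..
  qed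
  finally have S: "(\<Sum>v\<in>\<sigma>. (- 1) ^ card {u\<in>\<sigma>. u < v} * simplex_boundary (\<sigma> - {v}) \<rho>)
      = (\<Sum>v\<in>\<sigma>. \<Sum>w\<in>\<sigma>. if v = w then 0 else t v w)" .
  have "(\<Sum>v\<in>\<sigma>. \<Sum>w\<in>\<sigma>. if v = w then 0 else t v w)
      = (\<Sum>w\<in>\<sigma>. \<Sum>v\<in>\<sigma>. if v = w then 0 else t v w)"
    by (rule sum.swap)
  also have "\<dots> = (\<Sum>w\<in>\<sigma>. \<Sum>v\<in>\<sigma>. - (if w = v then 0 else t w v))"
  proof (intro sum.cong refl)
    fix v w assume "w \<in> \<sigma>" "v \<in> \<sigma>"
    thus "(if v = w then 0 else t v w) = - (if w = v then 0 else t w v)"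
      using anti[of v w] anti[of w v] by (cases v w rule: linorder_cases) auto
  qed
  also have "\<dots> = - (\<Sum>v\<in>\<sigma>. \<Sum>w\<in>\<sigma>. if v = w then 0 else t v w)"
    by (simp add: sum_negf)
  finally show ?thesis using S by simp
qed

lemma boundary_boundary:
  assumes "simplicial_complex V K"
  shows "boundary K (k - 1) (boundary K k f) = (\<lambda>_. 0)"
proof
  fix \<rho>
  have *: "(\<Sum>\<tau>\<in>faces K (k - 1). simplex_boundary \<sigma> \<tau> * simplex_boundary \<tau> \<rho>) = 0"
    if \<sigma>: "\<sigma> \<in> faces K k" for \<sigma>
  proof -
    let ?s = "\<lambda>v. (- 1 :: rat) ^ card {u\<in>\<sigma>. u < v}"
    have "(\<Sum>\<tau>\<in>faces K (k - 1). simplex_boundary \<sigma> \<tau> * simplex_boundary \<tau> \<rho>)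
        = (\<Sum>\<tau>\<in>faces K (k - 1). \<Sum>v\<in>\<sigma>.
             if \<tau> = \<sigma> - {v} then ?s v * simplex_boundary \<tau> \<rho> else 0)"
      unfolding simplex_boundary_def[of \<sigma>] sum_distrib_right
      by (intro sum.cong refl) simp
    also have "\<dots> = (\<Sum>v\<in>\<sigma>. \<Sum>\<tau>\<in>faces K (k - 1).
             if \<tau> = \<sigma> - {v} then ?s v * simplex_boundary \<tau> \<rho> else 0)"
      by (rule sum.swap)
    also have "\<dots> = (\<Sum>v\<in>\<sigma>. ?s v * simplex_boundary (\<sigma> - {v}) \<rho>)"
      using faces_diff[OF assms \<sigma>] finite_faces[OF assms]
      by (intro sum.cong refl) (simp add: sum.delta)
    also have "\<dots> = 0"
      using \<sigma> finite_simplex[OF assms] by (intro simplex_boundary_boundary) (auto simp: faces_def)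
    finally show ?thesis .
  qed
  have "boundary K (k - 1) (boundary K k f) \<rho>
      = (\<Sum>\<tau>\<in>faces K (k - 1). \<Sum>\<sigma>\<in>faces K k. f \<sigma> * (simplex_boundary \<sigma> \<tau> * simplex_boundary \<tau> \<rho>))"
    unfolding boundary_def sum_distrib_right by (simp add: mult.assoc)
  also have "\<dots> = (\<Sum>\<sigma>\<in>faces K k. f \<sigma> *
      (\<Sum>\<tau>\<in>faces K (k - 1). simplex_boundary \<sigma> \<tau> * simplex_boundary \<tau> \<rho>))"
    by (subst sum.swap) (simp add: sum_distrib_left)
  also have "\<dots> = 0" using * by simp
  finally show "boundary K (k - 1) (boundary K k f) \<rho> = 0" .
qed

lemma boundaries_subset_cycles:
  assumes "simplicial_complex V K"
  shows "boundaries K k \<subseteq> carrier (cycle_group K k)"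
  using boundary_closed[OF assms, of "k + 1"] boundary_boundary[OF assms, of "k + 1"]
  by (auto simp: boundaries_def cycle_group_def)

lemma subgroup_boundaries:
  assumes "simplicial_complex V K"
  shows "subgroup (boundaries K k) (cycle_group K k)"
proof -
  interpret Z: comm_group "cycle_group K k" by (rule comm_group_cycles)
  interpret C: comm_group "chain_group K (k + 1)" by (rule comm_group_chains)
  have "boundary K (k + 1) \<in> hom (chain_group K (k + 1)) (cycle_group K k)"
  proof (rule homI)
    fix f g assume "f \<in> carrier (chain_group K (k + 1))" "g \<in> carrier (chain_group K (k + 1))"
    show "boundary K (k + 1) (f \<otimes>\<^bsub>chain_group K (k + 1)\<^esub> g)
        = boundary K (k + 1) f \<otimes>\<^bsub>cycle_group K k\<^esub> boundary K (k + 1) g"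
      by (simp add: chain_group_def cycle_group_def fun_eq_iff boundary_add)
  qed (use boundaries_subset_cycles[OF assms] in \<open>auto simp: boundaries_def\<close>)
  then interpret group_hom "chain_group K (k + 1)" "cycle_group K k" "boundary K (k + 1)"
    by unfold_locales
  show ?thesis unfolding boundaries_def by (rule img_is_subgroup)
qed

lemma comm_group_homology:
  assumes "simplicial_complex V K"
  shows "comm_group (homology K k)"
  unfolding homology_def
  by (intro comm_group.abelian_FactGroup comm_group_cycles subgroup_boundaries[OF assms])

end

theory Submission
  imports Defs "HOL-Library.Function_Algebras"
begin

text \<open>
  The hypotheses on \<open>c\<close> say that \<open>c\<close> and \<open>-1\<close> generate a proper subgroup \<open>H\<close> of \<open>\<F>\<^sub>n\<^sup>*\<close>. Among the
  2-chains that are invariant under scaling by \<open>c\<close> and \<open>-1\<close>, the condition \<open>\<partial> = 0\<close> is automatic at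
  the edges containing \<open>0\<close>. The remaining unknowns and equations are both indexed by the space \<open>W\<close> of
  antisymmetric invariant functions of two nonzero residues, so \<open>\<partial>\<close> becomes an endomorphism of \<open>W\<close>.
  Since \<open>\<partial>\<partial> = 0\<close>, the functions \<open>w\<close> in its image satisfy \<open>(\<Sum>a. w a b) = 0\<close> for every \<open>b\<close>, whereas
  \<open>w a b = 1\<^sub>H(b) - 1\<^sub>H(a)\<close> does not. Hence the endomorphism is not onto, and by finite dimension it
  has a nonzero kernel.
\<close>

section \<open>Linear algebra: injectivity and surjectivity in finite dimension\<close>

text \<open>If \<open>T\<close> were injective on \<open>W\<close>, the image of a basis of
  \<open>W\<close> together with \<open>w\<close> would be an independent set in \<open>W\<close>
  with one element more than the basis.\<close>

lemma (in vector_space) nontrivial_kernel_on_subspace: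
  assumes lin: "Vector_Spaces.linear scale scale T" and W: "subspace W" and S: "finite S" "W \<subseteq> span S"
    and TW: "T ` W \<subseteq> W" and w: "w \<in> W" "w \<notin> T ` W"
  obtains v where "v \<in> W" "v \<noteq> 0" "T v = 0"
proof (rule ccontr)
  assume "\<not> thesis"
  with that have ker: "\<And>v. v \<in> W \<Longrightarrow> T v = 0 \<Longrightarrow> v = 0" by blast
  interpret T: Vector_Spaces.linear scale scale T by fact
  obtain B where B: "B \<subseteq> W" "independent B" "W \<subseteq> span B"
    by (rule maximal_independent_subset)
  have finB: "finite B"
    using independent_span_bound[OF S(1) B(2)] B(1) S(2) by blast
  have spanB: "span B = W"
    using B span_minimal[OF B(1) W] by blast
  have inj: "inj_on T W"
    using T.inj_on_iff_eq_0[OF W] ker by blast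
  have indep: "independent (T ` B)"
    using T.independent_injective_image[OF B(2)] inj spanB by simp
  have "w \<notin> span (T ` B)"
    using w(2) T.span_image[of B] spanB by simp
  hence "independent (insert w (T ` B))"
    using indep by (rule independent_insertI)
  moreover have "insert w (T ` B) \<subseteq> span B"
    using w(1) TW B(1) spanB by blast
  ultimately have "card (insert w (T ` B)) \<le> card B"
    using independent_span_bound[OF finB] by blast
  moreover have "w \<notin> T ` B" using w(2) B(1) by blast
  moreover have "card (T ` B) = card B"
    using inj B(1) by (meson card_image inj_on_subset)
  ultimately show False using finB by simp
qed

section \<open>Rational-valued functions of two residues\<close>

definition scale2 :: "rat \<Rightarrow> ('a \<Rightarrow> 'b \<Rightarrow> rat) \<Rightarrow> 'a \<Rightarrow> 'b \<Rightarrow> rat" where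
  "scale2 r g = (\<lambda>a b. r * g a b)"

interpretation fun2: vector_space scale2
  by unfold_locales (auto simp: scale2_def fun_eq_iff algebra_simps)

text \<open>Functions on pairs of residues are encoded as periodic functions on the integers, so
  that negation and affine substitutions need no reduction modulo \<open>n\<close>.\<close>

definition mod_periodic :: "int \<Rightarrow> (int \<Rightarrow> int \<Rightarrow> 'a) \<Rightarrow> bool" where
  "mod_periodic n g \<longleftrightarrow> (\<forall>a a' b b'. [a = a'] (mod n) \<longrightarrow> [b = b'] (mod n) \<longrightarrow> g a b = g a' b')"

lemma mod_periodicD:
  "mod_periodic n g \<Longrightarrow> [a = a'] (mod n) \<Longrightarrow> [b = b'] (mod n) \<Longrightarrow> g a b = g a' b'"
  unfolding mod_periodic_def by blast

text \<open>The indicators of the \<open>n * n\<close> pairs of residue classes span, with the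
  values of \<open>g\<close> as coefficients.\<close>

lemma mod_periodic_finite_span:
  assumes "n > 0"
  shows "\<exists>S. finite S \<and> {g. mod_periodic n g} \<subseteq> fun2.span S"
proof -
  define \<delta> where "\<delta> = (\<lambda>(i, j) a b. if a mod n = i \<and> b mod n = j then 1 else (0::rat))"
  let ?I = "{0..<n} \<times> {0..<n}"
  have "g \<in> fun2.span (\<delta> ` ?I)" if "mod_periodic n g" for g
  proof -
    have *: "(\<Sum>p\<in>I. F p) a b = (\<Sum>p\<in>I. F p a b)" if "finite I"
      for F :: "int \<times> int \<Rightarrow> int \<Rightarrow> int \<Rightarrow> rat" and I a b
      using that by (induction I rule: finite_induct) auto
    have "g a b = (\<Sum>p\<in>?I. scale2 (g (fst p) (snd p)) (\<delta> p)) a b" for a b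
    proof -
      have "(\<Sum>p\<in>?I. scale2 (g (fst p) (snd p)) (\<delta> p)) a b
          = (\<Sum>p\<in>?I. if p = (a mod n, b mod n) then g (fst p) (snd p) else 0)"
        unfolding *[OF finite_cartesian_product[OF finite_atLeastLessThan_int finite_atLeastLessThan_int]]
        by (intro sum.cong) (auto simp: scale2_def \<delta>_def split: if_splits)
      also have "\<dots> = g (a mod n) (b mod n)"
        using assms by (simp add: sum.delta)
      also have "\<dots> = g a b"
        by (rule mod_periodicD[OF that]) (auto simp: cong_def)
      finally show ?thesis by simp
    qed
    hence "g = (\<Sum>p\<in>?I. scale2 (g (fst p) (snd p)) (\<delta> p))" by blast
    also have "\<dots> \<in> fun2.span (\<delta> ` ?I)"
      by (intro fun2.span_sum fun2.span_scale fun2.span_base) auto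
    finally show ?thesis .
  qed
  thus ?thesis by (intro exI[of _ "\<delta> ` ?I"]) auto
qed

text \<open>Since \<open>v\<close> is a unit modulo \<open>n\<close>, the map
  \<open>a \<mapsto> u + v * a\<close> permutes the residues.\<close>

lemma sum_affine_residues:
  fixes h :: "int \<Rightarrow> 'a::comm_monoid_add"
  assumes "n > 0" and "coprime v n" and per: "\<And>x y. [x = y] (mod n) \<Longrightarrow> h x = h y"
  shows "(\<Sum>a\<in>{0..<n}. h (u + v * a)) = (\<Sum>a\<in>{0..<n}. h a)"
proof -
  let ?f = "\<lambda>a. (u + v * a) mod n"
  have "inj_on ?f {0..<n}"
  proof (rule inj_onI)
    fix a b assume ab: "a \<in> {0..<n}" "b \<in> {0..<n}" "?f a = ?f b"
    hence "[u + v * a = u + v * b] (mod n)" by (simp add: cong_def)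
    hence "[v * a = v * b] (mod n)" by (simp add: cong_add_lcancel)
    hence "[a = b] (mod n)" using assms(2) by (simp add: cong_mult_lcancel)
    thus "a = b" using ab by (simp add: cong_def)
  qed
  moreover from this have "?f ` {0..<n} = {0..<n}"
    using assms(1) by (intro endo_inj_surj) auto
  ultimately have "bij_betw ?f {0..<n} {0..<n}" by (simp add: bij_betw_def)
  hence "(\<Sum>a\<in>{0..<n}. h (?f a)) = (\<Sum>a\<in>{0..<n}. h a)" by (rule sum.reindex_bij_betw)
  moreover have "h (?f a) = h (u + v * a)" for a
    by (rule per) (simp add: cong_def)
  ultimately show ?thesis by simp
qed

section \<open>Invariant functions and the boundary operator on them\<close>

locale sum_cycle =
  fixes n c :: int
  assumes prime_n: "prime n" and c_nz: "\<not> n dvd c"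
    and c_plus_1: "\<not> n dvd 1 + c" and c_minus_1: "\<not> n dvd c - 1"
begin

lemma n_pos: "n > 0"
  using prime_n by (simp add: prime_gt_0_int)

lemma coprime_c: "coprime c n"
  using prime_n c_nz by (metis coprime_commute prime_imp_coprime)

lemma dvd_mult_c [simp]: "n dvd c * a \<longleftrightarrow> n dvd a"
  using prime_n c_nz by (simp add: prime_dvd_mult_iff)

lemma dvd_mult_Suc_c [simp]: "n dvd (1 + c) * a \<longleftrightarrow> n dvd a"
  using prime_n c_plus_1 by (simp add: prime_dvd_mult_iff)

definition invariant :: "(int \<Rightarrow> int \<Rightarrow> rat) \<Rightarrow> bool" where
  "invariant g \<longleftrightarrow> mod_periodic n g \<and> (\<forall>a b. g b a = - g a b) \<and>
     (\<forall>a b. g (c * a) (c * b) = g a b) \<and> (\<forall>a b. g (- a) (- b) = g a b)"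

definition W :: "(int \<Rightarrow> int \<Rightarrow> rat) set" where
  "W = {g. invariant g \<and> (\<forall>a b. n dvd a \<or> n dvd b \<longrightarrow> g a b = 0)}"

text \<open>
  A pair \<open>(a, b)\<close> with \<open>b = - (1 + c) a\<close> spans the degenerate triangle \<open>(a, b, a)\<close>, whose
  coefficient is irrelevant. Its value in \<open>g \<in> W\<close> is reused for the triangles with a vertex \<open>0\<close>.
\<close>

definition extend :: "(int \<Rightarrow> int \<Rightarrow> rat) \<Rightarrow> int \<Rightarrow> int \<Rightarrow> rat" where
  "extend g a b =
     (if n dvd a then (if n dvd b then 0 else g b (- ((1 + c) * b)))
      else if n dvd b then - g a (- ((1 + c) * a)) else g a b)"

text \<open>
  The coefficient at the edge \<open>(a, b)\<close> of the boundary of the 2-chain with coefficient \<open>e x\<^sub>0 x\<^sub>1\<close>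
  at the oriented triangle \<open>(x\<^sub>0, x\<^sub>1, x\<^sub>2)\<close>, where \<open>x\<^sub>0 + x\<^sub>1 + c x\<^sub>2 = 0\<close>.
\<close>

definition edge_coeff :: "(int \<Rightarrow> int \<Rightarrow> rat) \<Rightarrow> int \<Rightarrow> int \<Rightarrow> rat" where
  "edge_coeff e a b = e (- a - c * b) a + e a b + e b (- b - c * a)"

text \<open>For \<open>g \<in> W\<close> the invariance of \<open>extend g\<close> makes
  \<open>edge_coeff (extend g)\<close> vanish at the edges containing 0 anyway; setting the value 0
  here makes it immediate that \<open>T g\<close> vanishes there.\<close>

definition T :: "(int \<Rightarrow> int \<Rightarrow> rat) \<Rightarrow> int \<Rightarrow> int \<Rightarrow> rat" where
  "T g a b = (if n dvd a \<or> n dvd b then 0 else edge_coeff (extend g) a b)"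

lemma invariantD:
  assumes "invariant g"
  shows "mod_periodic n g" "g b a = - g a b" "g (c * a) (c * b) = g a b" "g (- a) (- b) = g a b"
  using assms unfolding invariant_def by blast+

lemma invariantI:
  assumes "\<And>a a' b b'. [a = a'] (mod n) \<Longrightarrow> [b = b'] (mod n) \<Longrightarrow> g a b = g a' b'"
    and "\<And>a b. g b a = - g a b" "\<And>a b. g (c * a) (c * b) = g a b" "\<And>a b. g (- a) (- b) = g a b"
  shows "invariant g"
  unfolding invariant_def mod_periodic_def using assms by blast

lemma W_I:
  assumes "invariant g" "\<And>a b. n dvd a \<or> n dvd b \<Longrightarrow> g a b = 0"
  shows "g \<in> W"
  unfolding W_def using assms by blast

lemma W_D:
  assumes "g \<in> W"
  shows "invariant g" "n dvd a \<or> n dvd b \<Longrightarrow> g a b = 0"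
  using assms unfolding W_def by blast+

text \<open>Multiplication by -1 swaps \<open>a\<close> and \<open>- a\<close>, so invariance and
  antisymmetry together force the value to equal its negative.\<close>

lemma invariant_antipodal:
  assumes "invariant g"
  shows "g a (- a) = 0" "g (- a) a = 0"
proof -
  have "g (- a) a = g a (- a)" using invariantD(4)[OF assms, of a "- a"] by simp
  thus "g a (- a) = 0" "g (- a) a = 0" using invariantD(2)[OF assms, of a "- a"] by auto
qed

text \<open>The reused values sit at pairs \<open>(b, - ((1 + c) * b))\<close>; scaling
  \<open>b\<close> by \<open>c\<close> or -1 scales the whole pair, so the invariance of
  \<open>g\<close> carries over.\<close>

lemma invariant_extend:
  assumes "g \<in> W"
  shows "invariant (extend g)"
proof -
  have g: "invariant g" using assms by (rule W_D)
  note gD = invariantD[OF g]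
  have "extend g a b = extend g a' b'" if "[a = a'] (mod n)" "[b = b'] (mod n)" for a a' b b'
  proof -
    have d: "n dvd a \<longleftrightarrow> n dvd a'" "n dvd b \<longleftrightarrow> n dvd b'"
      using that by (auto simp: cong_dvd_iff)
    have "g a b = g a' b'" using that by (rule mod_periodicD[OF gD(1)])
    moreover have "g b (- ((1 + c) * b)) = g b' (- ((1 + c) * b'))"
      by (rule mod_periodicD[OF gD(1)]) (use that in \<open>auto intro!: cong_mult simp: cong_minus_minus_iff\<close>)
    moreover have "g a (- ((1 + c) * a)) = g a' (- ((1 + c) * a'))"
      by (rule mod_periodicD[OF gD(1)]) (use that in \<open>auto intro!: cong_mult simp: cong_minus_minus_iff\<close>)
    ultimately show ?thesis by (simp add: extend_def d)
  qed
  moreover have "extend g b a = - extend g a b" for a b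
    using gD(2)[of b a] by (auto simp: extend_def)
  moreover have "extend g (c * a) (c * b) = extend g a b" for a b
  proof -
    have "g (c * x) (- ((1 + c) * (c * x))) = g x (- ((1 + c) * x))" for x
      using gD(3)[of x "- ((1 + c) * x)"] by (simp only: mult_minus_right mult.left_commute)
    thus ?thesis by (simp add: extend_def gD(3))
  qed
  moreover have "extend g (- a) (- b) = extend g a b" for a b
    using gD(4)[of a b] gD(4)[of a "- ((1 + c) * a)"] gD(4)[of b "- ((1 + c) * b)"]
    by (simp add: extend_def)
  ultimately show ?thesis by (rule invariantI)
qed

text \<open>The third vertices are linear in \<open>(a, b)\<close> and hence commute with scaling;
  exchanging \<open>a\<close> and \<open>b\<close> exchanges the two outer terms up to sign.\<close>

lemma invariant_edge_coeff:
  assumes "invariant e"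
  shows "invariant (edge_coeff e)"
proof -
  note eD = invariantD[OF assms]
  have "edge_coeff e a b = edge_coeff e a' b'" if "[a = a'] (mod n)" "[b = b'] (mod n)" for a a' b b'
  proof -
    have *: "[- x - c * y = - x' - c * y'] (mod n)" if "[x = x'] (mod n)" "[y = y'] (mod n)" for x x' y y'
      using that by (intro cong_diff cong_mult) (auto simp: cong_minus_minus_iff)
    have "e (- a - c * b) a = e (- a' - c * b') a'" "e a b = e a' b'"
      "e b (- b - c * a) = e b' (- b' - c * a')"
      using that * by (blast intro: mod_periodicD[OF eD(1)])+
    thus ?thesis by (simp add: edge_coeff_def)
  qed
  moreover have "edge_coeff e b a = - edge_coeff e a b" for a b
    using eD(2)[of "- b - c * a" b] eD(2)[of a b] eD(2)[of a "- a - c * b"]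
    by (simp add: edge_coeff_def)
  moreover have "edge_coeff e (c * a) (c * b) = edge_coeff e a b" for a b
    using eD(3)[of "- a - c * b" a] eD(3)[of a b] eD(3)[of b "- b - c * a"]
    by (simp add: edge_coeff_def algebra_simps)
  moreover have "edge_coeff e (- a) (- b) = edge_coeff e a b" for a b
    using eD(4)[of "- a - c * b" a] eD(4)[of a b] eD(4)[of b "- b - c * a"]
    by (simp add: edge_coeff_def algebra_simps)
  ultimately show ?thesis by (rule invariantI)
qed

lemma T_in_W:
  assumes "g \<in> W"
  shows "T g \<in> W"
proof -
  let ?d = "edge_coeff (extend g)"
  have d: "invariant ?d"
    by (intro invariant_edge_coeff invariant_extend assms)
  note dD = invariantD[OF d]
  have "T g a b = T g a' b'" if "[a = a'] (mod n)" "[b = b'] (mod n)" for a a' b b'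
    using mod_periodicD[OF dD(1) that] that by (simp add: T_def cong_dvd_iff)
  moreover have "T g b a = - T g a b" for a b
    using dD(2)[of b a] by (simp add: T_def)
  moreover have "T g (c * a) (c * b) = T g a b" for a b
    using dD(3)[of a b] by (simp add: T_def)
  moreover have "T g (- a) (- b) = T g a b" for a b
    using dD(4)[of a b] by (simp add: T_def)
  ultimately have "invariant (T g)" by (rule invariantI)
  thus ?thesis by (rule W_I) (auto simp: T_def)
qed

text \<open>At an edge \<open>(0, b)\<close> the condition \<open>\<partial> = 0\<close> reads \<open>e 0 b = e 0 (- c b)\<close>, which holds by invariance.\<close>

lemma edge_coeff_zero:
  assumes "invariant e" "n dvd a"
  shows "edge_coeff e a b = 0" "edge_coeff e b a = 0"
proof -
  note eD = invariantD[OF assms(1)]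
  have a0: "[a = 0] (mod n)" using assms(2) by (simp add: cong_0_iff)
  have "edge_coeff e a b = edge_coeff e 0 b"
    by (rule mod_periodicD[OF invariantD(1)[OF invariant_edge_coeff[OF assms(1)]] a0]) simp
  also have "\<dots> = e (- (c * b)) (- (c * 0)) + e 0 b + e b (- b)"
    by (simp add: edge_coeff_def)
  also have "\<dots> = 0"
    using eD(2)[of b 0] eD(4)[of "c * b" "c * 0"] eD(3)[of b 0]
    by (simp add: invariant_antipodal[OF assms(1)])
  finally show "edge_coeff e a b = 0" .
  thus "edge_coeff e b a = 0"
    using invariantD(2)[OF invariant_edge_coeff[OF assms(1)], of b a] by simp
qed

lemma sum_edge_coeff:
  assumes "invariant e"
  shows "(\<Sum>a\<in>{0..<n}. edge_coeff e a b) = 0"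
proof -
  note eD = invariantD[OF assms]
  let ?R = "{0..<n}"
  let ?r = "\<lambda>a. - a - c * b"
  have cop: "coprime (- 1) n" "coprime (- c) n" using coprime_c by auto
  \<comment> \<open>The involution \<open>a \<mapsto> - a - c * b\<close> reverses the arguments of
    \<open>e\<close>, so by antisymmetry this sum equals its own negative.\<close>
  have "(\<Sum>a\<in>?R. e (?r a) a) = (\<Sum>a\<in>?R. e (?r (- c * b + (- 1) * a)) (- c * b + (- 1) * a))"
    by (rule sum_affine_residues[symmetric, OF n_pos cop(1)])
      (auto intro!: mod_periodicD[OF eD(1)] cong_diff simp: cong_minus_minus_iff)
  also have "\<dots> = (\<Sum>a\<in>?R. e a (?r a))" by (simp add: algebra_simps)
  also have "\<dots> = - (\<Sum>a\<in>?R. e (?r a) a)"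
    unfolding sum_negf[symmetric] by (intro sum.cong refl eD(2))
  finally have 1: "(\<Sum>a\<in>?R. e (?r a) a) = 0" by simp
  \<comment> \<open>As \<open>- c\<close> is a unit, the second argument runs through all residues,
    and the sum cancels that of the middle terms.\<close>
  have "(\<Sum>a\<in>?R. e b (- b - c * a)) = (\<Sum>a\<in>?R. e b (- b + (- c) * a))" by simp
  also have "\<dots> = (\<Sum>a\<in>?R. e b a)"
    by (rule sum_affine_residues[OF n_pos cop(2)]) (auto intro!: mod_periodicD[OF eD(1)])
  also have "\<dots> = - (\<Sum>a\<in>?R. e a b)"
    unfolding sum_negf[symmetric] by (intro sum.cong refl eD(2))
  finally show ?thesis using 1 by (simp add: edge_coeff_def sum.distrib)
qed

lemma sum_T:
  assumes "g \<in> W"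
  shows "(\<Sum>a\<in>{0..<n}. T g a b) = 0"
proof -
  have "T g a b = edge_coeff (extend g) a b" for a
    using edge_coeff_zero[OF invariant_extend[OF assms]] by (auto simp: T_def)
  thus ?thesis using sum_edge_coeff[OF invariant_extend[OF assms]] by simp
qed

lemma subspace_W: "fun2.subspace W"
proof (rule fun2.subspaceI)
  show "0 \<in> W" by (intro W_I invariantI) auto
  fix f g assume f: "f \<in> W" and g: "g \<in> W"
  note fD = invariantD[OF W_D(1)[OF f]] and gD = invariantD[OF W_D(1)[OF g]]
  show "f + g \<in> W"
  proof (intro W_I invariantI)
    fix a a' b b' :: int assume ab: "[a = a'] (mod n)" "[b = b'] (mod n)"
    show "(f + g) a b = (f + g) a' b'"
      using mod_periodicD[OF fD(1) ab] mod_periodicD[OF gD(1) ab] by simp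
  next
    fix a b show "(f + g) b a = - (f + g) a b" using fD(2)[of b a] gD(2)[of b a] by simp
  qed (simp_all add: fD(3,4) gD(3,4) W_D(2)[OF f] W_D(2)[OF g])
next
  fix r g assume g: "g \<in> W"
  note gD = invariantD[OF W_D(1)[OF g]]
  show "scale2 r g \<in> W"
  proof (intro W_I invariantI)
    fix a a' b b' :: int assume ab: "[a = a'] (mod n)" "[b = b'] (mod n)"
    show "scale2 r g a b = scale2 r g a' b'"
      using mod_periodicD[OF gD(1) ab] by (simp add: scale2_def)
  next
    fix a b show "scale2 r g b a = - scale2 r g a b" using gD(2)[of b a] by (simp add: scale2_def)
  qed (simp_all add: scale2_def gD(3,4) W_D(2)[OF g])
qed

lemma linear_T: "Vector_Spaces.linear scale2 scale2 T"
  unfolding Vector_Spaces.linear_iff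
  by (auto simp: fun2.vector_space_axioms fun_eq_iff T_def edge_coeff_def extend_def scale2_def algebra_simps)

section \<open>Existence of a nonzero invariant solution\<close>

text \<open>The last two conclusions say that the vertex \<open>z\<close> with
  \<open>a + b + c * z = 0\<close> differs from \<open>b\<close> and from \<open>a\<close>, so that
  \<open>e a b\<close> is the coefficient of a genuine triangle.\<close>

lemma exists_cycle:
  fixes h :: "int \<Rightarrow> bool"
  assumes per: "\<And>x y. [x = y] (mod n) \<Longrightarrow> h x = h y"
    and hc: "\<And>x. h (c * x) = h x" and hneg: "\<And>x. h (- x) = h x"
    and u: "h u" "\<not> n dvd u" and v: "\<not> h v" "\<not> n dvd v"
  obtains e a b where "invariant e" "\<And>a b. edge_coeff e a b = 0"
    "e a b \<noteq> 0" "\<not> n dvd a + (1 + c) * b" "\<not> n dvd b + (1 + c) * a"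
proof -
  obtain S where S: "finite S" "W \<subseteq> fun2.span S"
    using mod_periodic_finite_span[OF n_pos] W_D(1) invariantD(1) by blast
  define w where "w a b = (if n dvd a \<or> n dvd b then 0 else of_bool (h b) - of_bool (h a) :: rat)" for a b
  have "w \<in> W"
  proof (intro W_I invariantI)
    fix a a' b b' :: int assume ab: "[a = a'] (mod n)" "[b = b'] (mod n)"
    show "w a b = w a' b'"
      using per[OF ab(1)] per[OF ab(2)] cong_dvd_iff[OF ab(1)] cong_dvd_iff[OF ab(2)] by (simp add: w_def)
  qed (auto simp: w_def hc hneg)
  moreover have "w \<notin> T ` W"
  proof
    assume "w \<in> T ` W"
    hence "(\<Sum>a\<in>{0..<n}. w a u) = 0" using sum_T by auto
    \<comment> \<open>As \<open>h u\<close> holds, column \<open>u\<close> of \<open>w\<close> has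
      only the entries 0 and 1, with 1 at the class of \<open>v\<close>; its sum cannot be
      0.\<close>
    moreover have "\<forall>a\<in>{0..<n}. w a u \<ge> 0" using u by (auto simp: w_def)
    ultimately have "w (v mod n) u = 0"
      using n_pos by (subst (asm) sum_nonneg_eq_0_iff) auto
    moreover have "w (v mod n) u = w v u"
      by (rule mod_periodicD[OF invariantD(1)[OF W_D(1)[OF \<open>w \<in> W\<close>]]]) (auto simp: cong_def)
    ultimately show False using u v by (simp add: w_def)
  qed
  ultimately obtain g where g: "g \<in> W" "g \<noteq> 0" "T g = 0"
    using fun2.nontrivial_kernel_on_subspace[OF linear_T subspace_W S] T_in_W by blast
  note g_inv = invariantD[OF W_D(1)[OF g(1)]]
  define e where "e = extend g"
  have e: "invariant e" unfolding e_def by (rule invariant_extend[OF g(1)])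
  have D: "edge_coeff e a b = 0" for a b
  proof (cases "n dvd a \<or> n dvd b")
    case True
    thus ?thesis using edge_coeff_zero[OF e] by blast
  next
    case False
    moreover have "T g a b = 0" using g(3) by simp
    ultimately show ?thesis by (simp add: T_def e_def)
  qed
  obtain a b where ab: "g a b \<noteq> 0" using g(2) by (auto simp: fun_eq_iff)
  hence nz: "\<not> n dvd a" "\<not> n dvd b" using W_D(2)[OF g(1)] by blast+
  note found = that[OF e D]
  \<comment> \<open>A nonzero value at a degenerate pair was copied by \<open>extend\<close> to
    \<open>(0, y)\<close>. The triangle there is genuine: its third vertex \<open>z\<close>
    satisfies \<open>c * z = - y\<close>, so it is not 0, and not \<open>y\<close> because
    \<open>c \<noteq> -1\<close>.\<close>
  have degenerate: thesis if "\<not> n dvd y" "g y x \<noteq> 0" "n dvd x + (1 + c) * y" for x y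
  proof (rule found)
    have "[x = - ((1 + c) * y)] (mod n)" using \<open>n dvd x + (1 + c) * y\<close> by (simp add: cong_iff_dvd_diff)
    from mod_periodicD[OF g_inv(1) cong_refl cong_sym[OF this]]
    have "g y (- ((1 + c) * y)) = g y x" .
    thus "e 0 y \<noteq> 0" using \<open>\<not> n dvd y\<close> \<open>g y x \<noteq> 0\<close> by (simp add: e_def extend_def)
  qed (use \<open>\<not> n dvd y\<close> in auto)
  show thesis
  proof (cases "n dvd a + (1 + c) * b \<or> n dvd b + (1 + c) * a")
    case True
    thus ?thesis
    proof
      assume "n dvd a + (1 + c) * b"
      moreover have "g b a \<noteq> 0" using ab g_inv(2)[of b a] by simp
      ultimately show thesis by (rule degenerate[OF nz(2), rotated])
    next
      assume "n dvd b + (1 + c) * a"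
      thus thesis by (rule degenerate[OF nz(1) ab])
    qed
  next
    case False
    moreover have "e a b \<noteq> 0" using ab nz by (simp add: e_def extend_def)
    ultimately show ?thesis using found by blast
  qed
qed

section \<open>From functions of pairs to alternating functions of triples\<close>

text \<open>The summands are the three choices of the vertex multiplied by \<open>c\<close>. Adding
  them makes the function alternating for invariant \<open>e\<close>, so it vanishes on repeated
  vertices.\<close>

definition triangle_coeff :: "(int \<Rightarrow> int \<Rightarrow> rat) \<Rightarrow> int \<Rightarrow> int \<Rightarrow> int \<Rightarrow> rat" where
  "triangle_coeff e x y z =
     (if n dvd x + y + c * z then e x y else 0) + (if n dvd y + z + c * x then e y z else 0) +
     (if n dvd z + x + c * y then e z x else 0)"

lemma triangle_coeff_cyclic: "triangle_coeff e y z x = triangle_coeff e x y z"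
  by (simp add: triangle_coeff_def)

lemma triangle_coeff_swap:
  assumes "invariant e"
  shows "triangle_coeff e y x z = - triangle_coeff e x y z"
  using invariantD(2)[OF assms, of x y] invariantD(2)[OF assms, of z y] invariantD(2)[OF assms, of x z]
  by (simp add: triangle_coeff_def add.commute)

lemma sum_residue_delta:
  assumes "\<And>x y. [x = y] (mod n) \<Longrightarrow> F x = F y"
  shows "(\<Sum>z\<in>{0..<n}. if n dvd z - t then F z else 0) = (F t :: rat)"
proof -
  have "(\<Sum>z\<in>{0..<n}. if n dvd z - t then F z else 0) = (\<Sum>z\<in>{0..<n}. if z = t mod n then F z else 0)"
    by (intro sum.cong) (auto simp: mod_eq_dvd_iff[symmetric])
  also have "\<dots> = F (t mod n)" using n_pos by simp
  also have "\<dots> = F t" by (rule assms) (simp add: cong_def)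
  finally show ?thesis .
qed

text \<open>Each of the three relations has exactly one solution \<open>z\<close> modulo
  \<open>n\<close>, and these solutions give the three terms of \<open>edge_coeff\<close>.\<close>

lemma sum_triangle_coeff:
  assumes "invariant e"
  shows "(\<Sum>z\<in>{0..<n}. triangle_coeff e z a b) = edge_coeff e a b"
proof -
  note per = mod_periodicD[OF invariantD(1)[OF assms]]
  have "(\<Sum>z\<in>{0..<n}. if n dvd z + a + c * b then e z a else 0) = e (- a - c * b) a"
    using sum_residue_delta[of "\<lambda>z. e z a" "- a - c * b"] per by (simp add: algebra_simps)
  moreover have "(\<Sum>z\<in>{0..<n}. if n dvd a + b + c * z then e a b else 0) = e a b"
  proof -
    have "(\<Sum>z\<in>{0..<n}. if n dvd (a + b) + c * z then e a b else 0)
        = (\<Sum>z\<in>{0..<n}. if n dvd z then e a b else 0)"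
      by (rule sum_affine_residues[OF n_pos coprime_c]) (simp add: cong_dvd_iff)
    thus ?thesis using sum_residue_delta[of "\<lambda>_. e a b" 0] by simp
  qed
  moreover have "(\<Sum>z\<in>{0..<n}. if n dvd b + z + c * a then e b z else 0) = e b (- b - c * a)"
    using sum_residue_delta[of "\<lambda>z. e b z" "- b - c * a"] per by (simp add: algebra_simps)
  ultimately show ?thesis
    by (simp add: triangle_coeff_def edge_coeff_def sum.distrib)
qed

text \<open>If a second relation held too, subtracting it would leave \<open>c - 1\<close> times a
  difference of two vertices; as \<open>c \<noteq> 1\<close>, these would coincide, and the pair
  would be degenerate.\<close>

lemma triangle_coeff_eq:
  assumes z: "n dvd a + b + c * z" and "\<not> n dvd a + (1 + c) * b" "\<not> n dvd b + (1 + c) * a"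
  shows "triangle_coeff e a b z = e a b"
proof -
  have False if *: "n dvd y + z + c * x" "n dvd x + y + c * z" "\<not> n dvd y + (1 + c) * x" for x y
  proof -
    have "n dvd (y + z + c * x) - (x + y + c * z)" using * by (intro dvd_diff)
    also have "(y + z + c * x) - (x + y + c * z) = (c - 1) * (x - z)" by (simp add: algebra_simps)
    finally have "n dvd x - z" using prime_n c_minus_1 by (simp add: prime_dvd_mult_iff)
    hence "n dvd (y + z + c * x) + (x - z)" using *(1) by (rule dvd_add[rotated])
    also have "(y + z + c * x) + (x - z) = y + (1 + c) * x" by (simp add: algebra_simps)
    finally show False using *(3) by blast
  qed
  from this[of b a] this[of a b] show ?thesis
    using assms by (auto simp: triangle_coeff_def add_ac)
qed

end

section \<open>Alternating functions as chains, and top-dimensional homology\<close>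

lemma simplex_boundary_insert:
  assumes "finite \<tau>" "z \<notin> \<tau>"
  shows "simplex_boundary (insert z \<tau>) \<tau> = (- 1) ^ card {u\<in>\<tau>. u < z}"
proof -
  have "{u\<in>insert z \<tau>. u < z} = {u\<in>\<tau>. u < z}" by auto
  moreover have "(\<Sum>v\<in>\<tau>. (- 1) ^ card {u\<in>insert z \<tau>. u < v} * (if \<tau> = insert z \<tau> - {v} then 1 else 0)) = (0::rat)"
    by (intro sum.neutral) auto
  ultimately show ?thesis
    using assms by (simp add: simplex_boundary_def)
qed

lemma sorted_list_of_set_triple:
  assumes "x < y" "y < z"
  shows "sorted_list_of_set {x, y, z} = [x, y, z]"
proof -
  have "{x, y, z} = set [x, y, z]" by simp
  moreover have "sorted_list_of_set (set [x, y, z]) = [x, y, z]"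
    by (rule sorted_list_of_set.idem_if_sorted_distinct) (use assms in auto)
  ultimately show ?thesis by (simp only:)
qed

text \<open>The chain takes the value of \<open>\<phi>\<close> at the increasingly sorted vertices.
  Sorting \<open>z\<close> into \<open>a < b\<close> costs the same sign as the boundary,
  \<open>(- 1)\<close> to the number of vertices below \<open>z\<close>, so the two signs
  cancel.\<close>

lemma alternating_cycle:
  fixes \<phi> :: "'a::linorder \<Rightarrow> 'a \<Rightarrow> 'a \<Rightarrow> rat"
  assumes K: "simplicial_complex V K"
    and swap: "\<And>x y z. \<phi> y x z = - \<phi> x y z" and cyclic: "\<And>x y z. \<phi> y z x = \<phi> x y z"
    and supp: "\<And>x y z. \<phi> x y z \<noteq> 0 \<Longrightarrow> {x, y, z} \<in> K"
    and bd: "\<And>a b. a \<in> V \<Longrightarrow> b \<in> V \<Longrightarrow> a < b \<Longrightarrow> (\<Sum>z\<in>V. \<phi> z a b) = 0"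
    and nz: "\<phi> x y z \<noteq> 0"
  shows "\<exists>f\<in>carrier (cycle_group K 2). f \<noteq> (\<lambda>_. 0)"
proof -
  define f where "f \<sigma> = (if \<sigma> \<in> faces K 2
      then \<phi> (sorted_list_of_set \<sigma> ! 0) (sorted_list_of_set \<sigma> ! 1) (sorted_list_of_set \<sigma> ! 2) else 0)" for \<sigma>
  have diag: "\<phi> x x z = 0" "\<phi> x z x = 0" "\<phi> z x x = 0" for x z
    using swap[of x x z] cyclic[of x x z] cyclic[of z x x] by auto
  have finV: "finite V" and KV: "K \<subseteq> Pow V" using K by (auto simp: simplicial_complex_def)
  have f_eq: "f {x, y, z} = \<phi> x y z" if "x < y" "y < z" for x y z
  proof (cases "{x, y, z} \<in> K")
    case True
    moreover have "x \<noteq> y" "y \<noteq> z" "x \<noteq> z" using that by auto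
    ultimately have "{x, y, z} \<in> faces K 2" by (auto simp: faces_def simplex_dim_def)
    thus ?thesis unfolding f_def sorted_list_of_set_triple[OF that] by simp
  next
    case False
    thus ?thesis using supp by (auto simp: f_def faces_def)
  qed
  have "boundary K 2 f \<tau> = 0" for \<tau>
  proof (cases "\<tau> \<in> faces K 1")
    case False
    thus ?thesis using boundary_closed[OF K, of 2 f] by (simp add: chain_group_def)
  next
    case True
    hence "card \<tau> = 2" "\<tau> \<subseteq> V" using KV by (auto simp: faces_def simplex_dim_def)
    then obtain a b where ab: "\<tau> = {a, b}" "a < b"
      by (metis card_2_iff insert_commute linorder_neqE)
    have abV: "a \<in> V" "b \<in> V" using ab \<open>\<tau> \<subseteq> V\<close> by auto
    have inj: "inj_on (\<lambda>z. insert z \<tau>) (V - \<tau>)" by (auto simp: inj_on_def)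
    \<comment> \<open>Only faces of the form \<open>insert z \<tau>\<close> have \<tau> in their
      boundary, and any such set that is not a face carries the default value 0 of
      \<open>f\<close>.\<close>
    have "boundary K 2 f \<tau> = (\<Sum>\<sigma>\<in>(\<lambda>z. insert z \<tau>) ` (V - \<tau>). f \<sigma> * simplex_boundary \<sigma> \<tau>)"
      unfolding boundary_def
    proof (rule sum.mono_neutral_cong[OF _ finite_faces[OF K]])
      show "f \<sigma> * simplex_boundary \<sigma> \<tau> = 0" if "\<sigma> \<in> faces K 2 - (\<lambda>z. insert z \<tau>) ` (V - \<tau>)" for \<sigma>
      proof -
        have "\<sigma> \<subseteq> V" using that KV by (auto simp: faces_def)
        hence "\<tau> \<noteq> \<sigma> - {v}" if "v \<in> \<sigma>" for v
          using that \<open>\<sigma> \<in> _\<close> by (auto simp: insert_absorb)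
        hence "simplex_boundary \<sigma> \<tau> = 0"
          unfolding simplex_boundary_def by (intro sum.neutral) auto
        thus ?thesis by simp
      qed
    qed (auto simp: f_def finV)
    also have "\<dots> = (\<Sum>z\<in>V - \<tau>. f (insert z \<tau>) * simplex_boundary (insert z \<tau>) \<tau>)"
      by (simp add: sum.reindex[OF inj])
    also have "\<dots> = (\<Sum>z\<in>V - \<tau>. \<phi> z a b)"
    proof (rule sum.cong[OF refl])
      fix z assume z: "z \<in> V - \<tau>"
      hence "simplex_boundary (insert z \<tau>) \<tau> = (- 1) ^ card {u\<in>\<tau>. u < z}"
        by (intro simplex_boundary_insert) (auto simp: ab)
      moreover consider "z < a" | "a < z" "z < b" | "b < z"
        using z ab by fastforce
      hence "f (insert z \<tau>) * (- 1) ^ card {u\<in>\<tau>. u < z} = \<phi> z a b"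
      proof cases
        case 1
        hence "{u\<in>\<tau>. u < z} = {}" using ab by auto
        hence "card {u\<in>\<tau>. u < z} = 0" by (simp only: card.empty)
        moreover have "f (insert z \<tau>) = \<phi> z a b" using f_eq[OF 1 ab(2)] by (simp only: ab(1))
        ultimately show ?thesis by (simp only: power_0 mult_1_right)
      next
        case 2
        hence "{u\<in>\<tau>. u < z} = {a}" using ab by auto
        hence "card {u\<in>\<tau>. u < z} = 1" using is_singletonI[of a] by (simp only: is_singleton_altdef)
        moreover have "insert z \<tau> = {a, z, b}" using ab by auto
        hence "f (insert z \<tau>) = \<phi> a z b" using f_eq[OF 2] by (simp only:)
        ultimately show ?thesis
          by (simp only: power_one_right mult_minus1_right swap[of a z b])
      next
        case 3
        hence "{u\<in>\<tau>. u < z} = \<tau>" using ab by auto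
        hence "card {u\<in>\<tau>. u < z} = 2" using \<open>card \<tau> = 2\<close> by (simp only:)
        moreover have "insert z \<tau> = {a, b, z}" using ab by auto
        hence "f (insert z \<tau>) = \<phi> z a b" using f_eq[OF ab(2) 3] cyclic[of a b z] cyclic[of z a b] by (simp only:)
        ultimately show ?thesis by (simp only: power2_minus power_one mult_1_right)
      qed
      ultimately show "f (insert z \<tau>) * simplex_boundary (insert z \<tau>) \<tau> = \<phi> z a b" by simp
    qed
    also have "\<dots> = (\<Sum>z\<in>V. \<phi> z a b)"
      by (rule sum.mono_neutral_left) (auto simp: finV ab diag)
    also have "\<dots> = 0" using bd abV ab(2) by blast
    finally show ?thesis .
  qed
  hence "f \<in> carrier (cycle_group K 2)"
    by (auto simp: cycle_group_def chain_group_def f_def)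
  \<comment> \<open>Permuting the triple changes at most the sign, so nonvanishing passes to the
    sorted triple.\<close>
  moreover have "\<exists>x y z. x < y \<and> y < z \<and> \<phi> x y z \<noteq> 0"
  proof -
    have "x \<noteq> y" "y \<noteq> z" "x \<noteq> z" using nz diag by auto
    moreover have "\<phi> y x z \<noteq> 0" "\<phi> y z x \<noteq> 0" "\<phi> z x y \<noteq> 0" "\<phi> x z y \<noteq> 0" "\<phi> z y x \<noteq> 0"
      using nz swap[of y x z] cyclic[of x y z] cyclic[of z x y] swap[of x z y] swap[of y z x] by auto
    ultimately show ?thesis using nz by (metis linorder_neqE)
  qed
  then obtain x y z where "x < y" "y < z" "\<phi> x y z \<noteq> 0" by blast
  hence "f {x, y, z} \<noteq> 0" by (simp add: f_eq)
  ultimately show ?thesis by force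
qed

text \<open>Without faces in dimension \<open>k + 1\<close> the only boundary is 0, so every
  homology class is a single cycle.\<close>

lemma top_homology_nontrivial:
  assumes "faces K (k + 1) = {}" and f: "f \<in> carrier (cycle_group K k)" "f \<noteq> (\<lambda>_. 0)"
  shows "\<not> trivial_group (homology K k)"
proof
  assume triv: "trivial_group (homology K k)"
  have "boundary K (k + 1) g = (\<lambda>_. 0)" for g
    using assms(1) by (simp add: boundary_def fun_eq_iff)
  moreover have "(\<lambda>_. 0) \<in> carrier (chain_group K (k + 1))" by (simp add: chain_group_def)
  ultimately have B: "boundaries K k = {\<lambda>_. 0}" by (auto simp: boundaries_def)
  have "boundaries K k #>\<^bsub>cycle_group K k\<^esub> f \<in> carrier (homology K k)"
    using f(1) by (auto simp: homology_def FactGroup_def RCOSETS_def)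
  hence "boundaries K k #>\<^bsub>cycle_group K k\<^esub> f = boundaries K k"
    using triv by (simp add: trivial_group_def homology_def FactGroup_def)
  hence "f = (\<lambda>_. 0)"
    by (simp add: B r_coset_def cycle_group_def chain_group_def)
  thus False using f(2) by blast
qed

section \<open>The subgroup of units generated by \<open>c\<close> and -1\<close>

lemma residue_class_separation:
  fixes n c :: nat
  assumes n: "prime n" and c: "\<not> n dvd c"
    and ord: "([n = 1] (mod 4) \<and> \<not> residue_primroot n c) \<or>
         ([n = 3] (mod 4) \<and> \<not> residue_primroot n c \<and> ord n c \<noteq> (n - 1) div 2)"
  obtains h :: "int \<Rightarrow> bool" and v :: int where
    "\<And>x y. [x = y] (mod int n) \<Longrightarrow> h x = h y" "\<And>x. h (int c * x) = h x" "\<And>x. h (- x) = h x"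
    "h 1" "\<not> h v" "\<not> int n dvd v"
proof -
  have cop: "coprime n c" using n c by (simp add: prime_imp_coprime)
  have "ord n c dvd n - 1" "ord n c \<noteq> n - 1"
    using order_divides_totient[OF cop] ord n cop prime_gt_0_nat[OF n]
    by (auto simp: totient_prime residue_primroot_def)
  \<comment> \<open>\<open>d\<close> is the lcm of \<open>ord n c\<close> and 2, the order of the
    subgroup generated by \<open>c\<close> and -1. As the unit group is cyclic, that subgroup is the
    solution set of \<open>x ^ d = 1\<close>, which \<open>h\<close> tests below.\<close>
  define d where "d = (if even (ord n c) then ord n c else 2 * ord n c)"
  have pos: "ord n c > 0" using cop by simp
  have n1: "n > 1" using n by (rule prime_gt_1_nat)
  have "odd n" using ord by (auto simp: cong_def) presburger+
  have d: "even d" "ord n c dvd d" "\<not> n - 1 dvd d"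
  proof -
    show "even d" "ord n c dvd d" by (auto simp: d_def)
    obtain m where m: "n - 1 = ord n c * m" using \<open>ord n c dvd n - 1\<close> by blast
    have "m \<noteq> 0" using m n1 by (intro notI) simp
    moreover have "m \<noteq> 1" using m \<open>ord n c \<noteq> n - 1\<close> by auto
    ultimately have "2 * ord n c \<le> m * ord n c" by (intro mult_le_mono1) simp
    hence le: "2 * ord n c \<le> n - 1" using m by (simp only: mult.commute)
    \<comment> \<open>For odd \<open>ord n c\<close> the equality would force
      \<open>n mod 4 = 3\<close>, where this order is excluded by assumption.\<close>
    have ne: "2 * ord n c \<noteq> n - 1" if "odd (ord n c)"
    proof
      assume *: "2 * ord n c = n - 1"
      with that have "n mod 4 = 3" using n1 by presburger
      hence "ord n c \<noteq> (n - 1) div 2" using ord by (auto simp: cong_def)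
      thus False using * by linarith
    qed
    have "d < n - 1 \<and> d > 0"
    proof (cases "even (ord n c)")
      case True
      hence "d = ord n c" by (simp only: d_def if_True)
      thus ?thesis using le pos by linarith
    next
      case False
      hence "d = 2 * ord n c" by (simp only: d_def if_False)
      thus ?thesis using le ne[OF False] pos by linarith
    qed
    thus "\<not> n - 1 dvd d" by (auto dest: dvd_imp_le)
  qed
  define h where "h x = [x ^ d = 1] (mod int n)" for x
  have cd: "[int c ^ d = 1] (mod int n)"
  proof -
    have "[c ^ d = 1] (mod n)" using d(2) by (simp only: ord_divides)
    hence "[int (c ^ d) = int 1] (mod int n)" by (simp only: cong_int_iff)
    thus ?thesis by simp
  qed
  \<comment> \<open>A primitive root has order \<open>n - 1\<close>, which does not divide
    \<open>d\<close>, so it lies outside the subgroup.\<close>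
  obtain g where g: "residue_primroot n g" using prime_primitive_root_exists[OF n1 n] by blast
  hence "ord n g = n - 1" "coprime n g" using n by (auto simp: residue_primroot_def totient_prime)
  show thesis
  proof (rule that[of h "int g"])
    show "h x = h y" if "[x = y] (mod int n)" for x y
      using cong_pow[OF that, of d] by (metis h_def cong_sym cong_trans)
    show "h (int c * x) = h x" for x
    proof -
      have "[(int c * x) ^ d = x ^ d] (mod int n)"
        using cong_mult[OF cd cong_refl[of "x ^ d"]] by (simp add: power_mult_distrib)
      thus ?thesis by (metis h_def cong_sym cong_trans)
    qed
    show "h (- x) = h x" for x using d(1) by (simp add: h_def)
    show "h 1" by (simp add: h_def)
    show "\<not> h (int g)"
    proof
      assume "h (int g)"
      hence "[int (g ^ d) = int 1] (mod int n)" by (simp add: h_def)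
      hence "[g ^ d = 1] (mod n)" by (simp only: cong_int_iff)
      thus False using d(3) by (simp only: ord_divides \<open>ord n g = n - 1\<close>)
    qed
    show "\<not> int n dvd int g"
      using \<open>coprime n g\<close> n1 by (auto simp: coprime_absorb_left)
  qed
qed

section \<open>Transfer of the solution to a 2-cycle on the vertices \<open>{..<n}\<close>\<close>

theorem theorem2:
  fixes n c :: nat
  assumes "prime n"
    and "c < n"
    and "[int c \<noteq> 0] (mod int n)" "[int c \<noteq> 1] (mod int n)"
        "[int c \<noteq> - 1] (mod int n)" "[int c \<noteq> - 2] (mod int n)"
    and "([n = 1] (mod 4) \<and> \<not> residue_primroot n c) \<or>
         ([n = 3] (mod 4) \<and> \<not> residue_primroot n c \<and> ord n c \<noteq> (n - 1) div 2)"
  shows "\<not> Q_acyclic (sum_complex n c) \<and>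
         \<not> trivial_group (homology (sum_complex n c) 2) \<and>
         \<not> hypertree 2 {..<n} (sum_complex n c)"
proof -
  interpret sum_cycle "int n" "int c"
    using assms(1,3-5) by unfold_locales (auto simp: cong_iff_dvd_diff cong_0_iff add.commute)
  have "\<not> n dvd c" using c_nz by simp
  then obtain h v where h: "\<And>x y. [x = y] (mod int n) \<Longrightarrow> h x = h y" "\<And>x. h (int c * x) = h x"
    "\<And>x. h (- x) = h x" "h 1" "\<not> h v" "\<not> int n dvd v"
    using residue_class_separation[OF assms(1) _ assms(7)] by blast
  have "\<not> int n dvd 1" using prime_gt_1_nat[OF assms(1)] by simp
  then obtain e a b where e: "invariant e" "\<And>a b. edge_coeff e a b = 0"
    and ab: "e a b \<noteq> 0" "\<not> int n dvd a + (1 + int c) * b" "\<not> int n dvd b + (1 + int c) * a"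
    using exists_cycle[OF h(1-4) _ h(5,6)] by blast
  \<comment> \<open>The value 0 outside \<open>{..<n}\<close> keeps the function alternating on all
    triples and its support within the vertex set.\<close>
  define \<phi> where "\<phi> x y z =
      (if x < n \<and> y < n \<and> z < n then triangle_coeff e (int x) (int y) (int z) else 0)" for x y z
  have swap: "\<phi> y x z = - \<phi> x y z" for x y z
    using triangle_coeff_swap[OF e(1), of "int y" "int x" "int z"] by (auto simp: \<phi>_def)
  have cyclic: "\<phi> y z x = \<phi> x y z" for x y z
    using triangle_coeff_cyclic[of e "int y" "int z" "int x"] by (auto simp: \<phi>_def)
  have supp: "{x, y, z} \<in> sum_complex n c" if "\<phi> x y z \<noteq> 0" for x y z
  proof -
    have "x \<noteq> y" "y \<noteq> z" "z \<noteq> x"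
      using that swap[of x x z] swap[of y y x] swap[of z z y] cyclic[of x y y] cyclic[of z y z] cyclic[of y z z]
        cyclic[of z x z] cyclic[of y z y] cyclic[of x y x] by auto
    moreover have tri: "x < n" "y < n" "z < n" "triangle_coeff e (int x) (int y) (int z) \<noteq> 0"
      using that by (auto simp: \<phi>_def split: if_splits)
    moreover have "int n dvd int u + int v + int c * int w \<longleftrightarrow> [u + v + c * w = 0] (mod n)" for u v w
      unfolding cong_0_iff by (metis of_nat_add of_nat_mult int_dvd_int_iff)
    hence "[x + y + c * z = 0] (mod n) \<or> [y + z + c * x = 0] (mod n) \<or> [z + x + c * y = 0] (mod n)"
      using tri(4) by (auto simp: triangle_coeff_def split: if_splits)
    hence "\<exists>x\<^sub>0 x\<^sub>1 x\<^sub>2. {x, y, z} = {x\<^sub>0, x\<^sub>1, x\<^sub>2} \<and> [x\<^sub>0 + x\<^sub>1 + c * x\<^sub>2 = 0] (mod n)"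
      by (metis insert_commute)
    ultimately show ?thesis by (simp add: sum_complex_def)
  qed
  have "(\<Sum>z<n. \<phi> z a b) = 0" if "a \<in> {..<n}" "b \<in> {..<n}" for a b
  proof -
    have "(\<Sum>z<n. \<phi> z a b) = (\<Sum>z<n. triangle_coeff e (int z) (int a) (int b))"
      using that by (intro sum.cong) (auto simp: \<phi>_def)
    also have "\<dots> = (\<Sum>z\<in>int ` {..<n}. triangle_coeff e z (int a) (int b))"
      by (simp add: sum.reindex)
    also have "int ` {..<n} = {0..<int n}"
      by (simp add: lessThan_atLeast0 image_int_atLeastLessThan)
    finally show ?thesis using e by (simp add: sum_triangle_coeff)
  qed
  moreover obtain x y z where "\<phi> x y z \<noteq> 0"
  proof -
    \<comment> \<open>\<open>y\<close> inverts \<open>c\<close> modulo \<open>n\<close>, so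
      \<open>y * - (a + b)\<close> is the third vertex of the triangle at the pair
      \<open>(a, b)\<close>; reducing all three vertices modulo \<open>n\<close> keeps the
      coefficient \<open>e a b\<close>.\<close>
    obtain y where "[int c * y = 1] (mod int n)"
      using cong_solve_coprime_int[OF coprime_c] by blast
    hence "[int c * (y * - (a + b)) = 1 * - (a + b)] (mod int n)"
      using cong_scalar_right by (metis mult.assoc)
    hence z: "int n dvd a + b + int c * (y * - (a + b))"
      by (simp add: cong_iff_dvd_diff algebra_simps)
    define r where "r t = nat (t mod int n)" for t
    have r: "int (r t) = t mod int n" "[t mod int n = t] (mod int n)" "r t < n" for t
      using n_pos by (auto simp: r_def cong_def nat_less_iff)
    let ?z = "y * - (a + b)"
    have "triangle_coeff e (int (r a)) (int (r b)) (int (r ?z)) = e (int (r a)) (int (r b))"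
    proof (rule triangle_coeff_eq, unfold r(1))
      show "int n dvd a mod int n + b mod int n + int c * (?z mod int n)"
        using z cong_dvd_iff[OF cong_add[OF cong_add[OF r(2)[of a] r(2)[of b]]
          cong_mult[OF cong_refl[of "int c"] r(2)[of ?z]]]] by simp
      show "\<not> int n dvd a mod int n + (1 + int c) * (b mod int n)"
        using ab(2) cong_dvd_iff[OF cong_add[OF r(2)[of a] cong_mult[OF cong_refl[of "1 + int c"] r(2)[of b]]]] by simp
      show "\<not> int n dvd b mod int n + (1 + int c) * (a mod int n)"
        using ab(3) cong_dvd_iff[OF cong_add[OF r(2)[of b] cong_mult[OF cong_refl[of "1 + int c"] r(2)[of a]]]] by simp
    qed
    also have "\<dots> = e a b"
      unfolding r(1) using mod_periodicD[OF invariantD(1)[OF e(1)] r(2) r(2)] .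
    finally have "\<phi> (r a) (r b) (r ?z) \<noteq> 0" using ab(1) r(3) by (simp add: \<phi>_def)
    thus ?thesis by (rule that)
  qed
  ultimately obtain f where "f \<in> carrier (cycle_group (sum_complex n c) 2)" "f \<noteq> (\<lambda>_. 0)"
    using alternating_cycle[of "{..<n}" "sum_complex n c" \<phi>, OF simplicial_complex_sum_complex swap cyclic supp]
    by blast
  moreover have "faces (sum_complex n c) (2 + 1) = {}"
    by (auto simp: faces_def sum_complex_def simplex_dim_def)
  ultimately have "\<not> trivial_group (homology (sum_complex n c) 2)"
    using top_homology_nontrivial by blast
  thus ?thesis by (auto simp: Q_acyclic_def hypertree_def)
qed

end
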